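(* Let $a<b$ be real numbers, and let $f:[a, b] \to \mathbb{R}$ be continuous on $[a, b]$ and specularly differentiable on $(a, b)$. Then there exist $c_1, c_2 \in (a, b)$ such that $$f^{\mathrm{sd}}(c_1) \leq \frac{f(b) - f(a)}{b - a} \leq f^{\mathrm{sd}}(c_2).$$
   Context: For a real-valued function $f$ defined on a neighborhood of $x\in\mathbb{R}$, the specular derivative of $f$ at $x$ is $$f^{\mathrm{sd}}(x) := \lim_{h \searrow 0} \mathcal{A}(f(x + h) - f(x), f(x) - f(x - h), h)$$ (with $h>0$ small enough that $x\pm h$ lie in the domain), where $\mathcal{A}:\mathbb{R}\times\mathbb{R}\times(0,\infty)\to\mathbb{R}$ is $$\mathcal{A}(a, b, c) := \frac{a \sqrt{b^2 + c^2} + b \sqrt{a^2 + c^2}}{c \sqrt{a^2 + c^2} + c \sqrt{b^2 + c^2}}.$$ $f$ is specularly differentiable at $x$ if this limit exists as a finite real number, and specularly differentiable on an open interval if it is so at every point of that interval. *)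

theory Defs
  imports "HOL-Analysis.Analysis"
begin

text \<open>Only arguments with \<open>c > 0\<close> matter: below, \<open>c\<close> is the increment \<open>h\<close>, and the limit is
  taken along \<^term>\<open>at_right (0::real)\<close>.\<close>

definition specular_A :: "real \<Rightarrow> real \<Rightarrow> real \<Rightarrow> real" where
  "specular_A a b c =
     (a * sqrt (b\<^sup>2 + c\<^sup>2) + b * sqrt (a\<^sup>2 + c\<^sup>2)) /
     (c * sqrt (a\<^sup>2 + c\<^sup>2) + c * sqrt (b\<^sup>2 + c\<^sup>2))"

definition specular_quotient :: "(real \<Rightarrow> real) \<Rightarrow> real \<Rightarrow> real \<Rightarrow> real" where
  "specular_quotient f x h = specular_A (f (x + h) - f x) (f x - f (x - h)) h"

text \<open>Functions are total here, but the two notions below depend only on the values of \<open>f\<close> in an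
  arbitrarily small neighbourhood of \<open>x\<close>, so a function given only near \<open>x\<close> may be extended
  arbitrarily. The value \<open>specular_deriv f x\<close> is meaningful only if the limit exists, that is, if
  \<open>f\<close> is specularly differentiable at \<open>x\<close>.\<close>

definition specularly_differentiable_at :: "(real \<Rightarrow> real) \<Rightarrow> real \<Rightarrow> bool" where
  "specularly_differentiable_at f x \<longleftrightarrow>
     (\<exists>L::real. (specular_quotient f x \<longlongrightarrow> L) (at_right 0))"

definition specular_deriv :: "(real \<Rightarrow> real) \<Rightarrow> real \<Rightarrow> real" where
  "specular_deriv f x = Lim (at_right 0) (specular_quotient f x)"

definition specularly_differentiable_on :: "(real \<Rightarrow> real) \<Rightarrow> real set \<Rightarrow> bool" where
  "specularly_differentiable_on f S \<longleftrightarrow> (\<forall>x\<in>S. specularly_differentiable_at f x)"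

end

theory Submission
  imports Defs
begin

text \<open>
  Divided by the increment, the first two arguments of \<^const>\<open>specular_A\<close> become the right and the
  left difference quotient, and \<^const>\<open>specular_A\<close> is a weighted mean of these with positive weights.
  Hence it is at least \<open>m\<close> as soon as both difference quotients are. The weights depend on the
  difference quotients themselves, so the specular derivative is not linear in \<open>f\<close> and one cannot
  reduce to the case \<open>m = 0\<close> by subtracting a linear function from \<open>f\<close>. It is still useful to
  look at \<open>g x = f x - m * x\<close>, where \<open>m\<close> is the slope of the chord: by the mean property, a point
  \<open>c\<close> satisfies \<open>specular_deriv f c \<ge> m\<close> if \<open>g \<le> g c\<close> to the left of \<open>c\<close> and \<open>g \<ge> g c\<close> at
  points arbitrarily close to \<open>c\<close> on the right (\<open>specular_deriv_ge\<close>).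

  Such a point exists whenever \<open>g\<close> takes a larger value after a smaller one, namely where \<open>g\<close> first
  crosses an intermediate level (\<open>first_crossing\<close>). Since \<open>g\<close> has equal values at \<open>a\<close> and \<open>b\<close>,
  it either increases somewhere in this sense or is constant, and in the second case every
  interior point will do. The upper bound for the other point follows by passing to \<open>- f\<close>, because
  the specular derivative is odd in \<open>f\<close>.
\<close>

text \<open>The mean property. The weights of \<open>a / c\<close> and \<open>b / c\<close> are proportional to
  \<open>sqrt (b\<^sup>2 + c\<^sup>2)\<close> and \<open>sqrt (a\<^sup>2 + c\<^sup>2)\<close>.\<close>

lemma specular_A_ge:
  assumes "c > 0" "m * c \<le> a" "m * c \<le> b"
  shows "m \<le> specular_A a b c"
proof -
  define s where "s = sqrt (a\<^sup>2 + c\<^sup>2)"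
  define t where "t = sqrt (b\<^sup>2 + c\<^sup>2)"
  have pos: "s > 0" "t > 0"
    using assms(1) by (simp_all add: s_def t_def add_nonneg_pos)
  have "m * c * t \<le> a * t" "m * c * s \<le> b * s"
    using assms pos by (intro mult_right_mono; simp)+
  then have "m * (c * s + c * t) \<le> a * t + b * s"
    by (simp add: algebra_simps)
  moreover have "c * s + c * t > 0"
    using pos assms(1) by (simp add: add_pos_pos)
  ultimately have "m \<le> (a * t + b * s) / (c * s + c * t)"
    by (simp add: pos_le_divide_eq)
  then show ?thesis
    unfolding specular_A_def s_def t_def .
qed

lemma specular_quotient_tendsto:
  assumes "specularly_differentiable_at f x"
  shows "(specular_quotient f x \<longlongrightarrow> specular_deriv f x) (at_right 0)"
  using assms unfolding specularly_differentiable_at_def specular_deriv_def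
  by (metis tendsto_Lim trivial_limit_at_right_real)

lemma specular_quotient_uminus:
  "specular_quotient (\<lambda>x. - f x) x = (\<lambda>h. - specular_quotient f x h)"
proof
  fix h
  have odd: "specular_A (- u) (- v) h = - specular_A u v h" for u v
    unfolding specular_A_def by (simp add: minus_divide_left del: divide_minus_left)
  show "specular_quotient (\<lambda>x. - f x) x h = - specular_quotient f x h"
    unfolding specular_quotient_def odd [symmetric] by simp
qed

lemma specularly_differentiable_uminus:
  assumes "specularly_differentiable_at f x"
  shows "specularly_differentiable_at (\<lambda>x. - f x) x"
    and "specular_deriv (\<lambda>x. - f x) x = - specular_deriv f x"
proof -
  have lim: "(specular_quotient (\<lambda>x. - f x) x \<longlongrightarrow> - specular_deriv f x) (at_right 0)"
    unfolding specular_quotient_uminus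
    by (intro tendsto_minus specular_quotient_tendsto assms)
  then show "specularly_differentiable_at (\<lambda>x. - f x) x"
    unfolding specularly_differentiable_at_def by blast
  show "specular_deriv (\<lambda>x. - f x) x = - specular_deriv f x"
    unfolding specular_deriv_def [of "\<lambda>x. - f x"] by (intro tendsto_Lim lim) simp
qed

text \<open>On the right it suffices to control increments tending to \<open>0\<close>, since the limit is known to
  exist; on the left one then needs control at the mirrored points, whose position is unknown, and
  hence at all points near \<open>c\<close>.\<close>

lemma specular_deriv_ge:
  fixes f :: "real \<Rightarrow> real"
  assumes diff: "specularly_differentiable_at f c"
    and "p < c"
    and left: "\<And>x. x \<in> {p..<c} \<Longrightarrow> f x - m * x \<le> f c - m * c"
    and right: "\<And>e. e > 0 \<Longrightarrow> \<exists>x. c < x \<and> x < c + e \<and> f c - m * c \<le> f x - m * x"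
  shows "m \<le> specular_deriv f c"
proof (rule ccontr)
  assume "\<not> m \<le> specular_deriv f c"
  then have "eventually (\<lambda>h. specular_quotient f c h < m) (at_right 0)"
    using order_tendstoD(2) [OF specular_quotient_tendsto [OF diff]] by simp
  then obtain e where e: "e > 0" "\<And>h. 0 < h \<Longrightarrow> h < e \<Longrightarrow> specular_quotient f c h < m"
    by (auto simp: eventually_at_right_field)
  obtain x where x: "c < x" "x < c + min e (c - p)" "f c - m * c \<le> f x - m * x"
    using right [of "min e (c - p)"] e(1) \<open>p < c\<close> by auto
  define h where "h = x - c"
  have h: "0 < h" "h < e" "c - h \<in> {p..<c}"
    using x by (auto simp: h_def)
  have "m * h \<le> f (c + h) - f c"
    using x(3) by (simp add: h_def algebra_simps)
  moreover have "m * h \<le> f c - f (c - h)"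
    using left [OF h(3)] by (simp add: algebra_simps)
  ultimately have "m \<le> specular_quotient f c h"
    unfolding specular_quotient_def using h(1) by (intro specular_A_ge)
  with e(2) [OF h(1,2)] show False
    by simp
qed

text \<open>The point is the infimum of the set where \<open>g\<close> exceeds a level strictly between \<open>g p\<close> and
  \<open>g q\<close>. By continuity \<open>g\<close> attains exactly that level there, so the point lies strictly inside
  the interval.\<close>

lemma first_crossing:
  fixes g :: "real \<Rightarrow> real"
  assumes "p < q" and cont: "continuous_on {p..q} g" and "g p < g q"
  obtains c where "p < c" "c < q" "\<And>x. x \<in> {p..<c} \<Longrightarrow> g x \<le> g c"
    "\<And>e. e > 0 \<Longrightarrow> \<exists>x. c < x \<and> x < c + e \<and> g c \<le> g x"
proof -
  obtain k where k: "g p < k" "k < g q"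
    using dense [OF \<open>g p < g q\<close>] by blast
  define S where "S = {x \<in> {p..q}. k < g x}"
  define c where "c = Inf S"
  have q: "q \<in> S"
    using k \<open>p < q\<close> by (simp add: S_def)
  have bdd: "bdd_below S"
    by (rule bdd_belowI [of _ p]) (simp add: S_def)
  have low: "c \<le> x" if "x \<in> S" for x
    unfolding c_def using that bdd by (rule cInf_lower)
  have "closed {x \<in> {p..q}. k \<le> g x}"
    using continuous_closed_preimage [OF cont, of "{k..}"]
    by (simp add: vimage_def Int_def)
  then have "closure S \<subseteq> {x \<in> {p..q}. k \<le> g x}"
    by (rule closure_minimal [rotated]) (auto simp: S_def)
  moreover have "c \<in> closure S"
    unfolding c_def using q bdd by (intro closure_contains_Inf) auto
  ultimately have c: "p \<le> c" "c \<le> q" "k \<le> g c"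
    by auto
  have pc: "p < c"
    using c k by (cases "c = p") auto
  have left: "g x \<le> k" if "x \<in> {p..<c}" for x
    using low [of x] that c by (fastforce simp: S_def)
  have "closed {x \<in> {p..q}. g x \<le> k}"
    using continuous_closed_preimage [OF cont, of "{..k}"]
    by (simp add: vimage_def Int_def)
  then have "closure {p..<c} \<subseteq> {x \<in> {p..q}. g x \<le> k}"
    using left c by (intro closure_minimal) auto
  then have gc: "g c = k"
    using pc c(3) by (auto dest: subsetD [of _ _ c])
  show thesis
  proof (rule that [of c])
    show "c < q"
      using gc c k by (cases "c = q") auto
    show "\<exists>x. c < x \<and> x < c + e \<and> g c \<le> g x" if e: "e > 0" for e
    proof -
      obtain x where x: "x \<in> S" "x < c + e"
        using cInf_lessD [of S "c + e"] q e by (auto simp: c_def)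
      then have "k < g x" "c \<le> x"
        using low by (auto simp: S_def)
      then show ?thesis
        using x gc by (intro exI [of _ x]) (cases "x = c"; auto)
    qed
  qed (use pc left gc in auto)
qed

lemma specular_deriv_ge_slope_strict:
  fixes f :: "real \<Rightarrow> real"
  assumes "p < q" and cont: "continuous_on {p..q} f"
    and diff: "specularly_differentiable_on f {p<..<q}"
    and "f p - m * p < f q - m * q"
  shows "\<exists>c\<in>{p<..<q}. m \<le> specular_deriv f c"
proof -
  have "continuous_on {p..q} (\<lambda>x. f x - m * x)"
    by (intro continuous_intros cont)
  then show ?thesis
  proof (rule first_crossing [OF \<open>p < q\<close> _ assms(4)])
    fix c
    assume c: "p < c" "c < q"
      and left: "\<And>x. x \<in> {p..<c} \<Longrightarrow> f x - m * x \<le> f c - m * c"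
      and right: "\<And>e. e > 0 \<Longrightarrow> \<exists>x. c < x \<and> x < c + e \<and> f c - m * c \<le> f x - m * x"
    have "specularly_differentiable_at f c"
      using diff c by (simp add: specularly_differentiable_on_def)
    then have "m \<le> specular_deriv f c"
      by (rule specular_deriv_ge [OF _ c(1) left right])
    with c show ?thesis
      by auto
  qed
qed

text \<open>One half of the mean value inequality. Here \<open>g\<close> has equal values at both ends, so a
  value different from these increases either on the way to it or on the way back.\<close>

lemma specular_deriv_ge_slope:
  fixes f :: "real \<Rightarrow> real"
  assumes ab: "a < b" and cont: "continuous_on {a..b} f"
    and diff: "specularly_differentiable_on f {a<..<b}"
  shows "\<exists>c\<in>{a<..<b}. (f b - f a) / (b - a) \<le> specular_deriv f c"
proof -
  define m where "m = (f b - f a) / (b - a)"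
  define g where "g x = f x - m * x" for x
  have "m * (b - a) = f b - f a"
    using ab by (simp add: m_def)
  then have ends: "g a = g b"
    by (simp add: g_def algebra_simps)
  have sub: "\<exists>c\<in>{a<..<b}. m \<le> specular_deriv f c"
    if pq: "a \<le> p" "p < q" "q \<le> b" "g p < g q" for p q
  proof -
    have "continuous_on {p..q} f"
      using pq by (intro continuous_on_subset [OF cont]) auto
    moreover have "specularly_differentiable_on f {p<..<q}"
      using diff pq by (auto simp: specularly_differentiable_on_def)
    ultimately have "\<exists>c\<in>{p<..<q}. m \<le> specular_deriv f c"
      using pq by (intro specular_deriv_ge_slope_strict) (auto simp: g_def)
    then show ?thesis
      using pq by force
  qed
  have "\<exists>c\<in>{a<..<b}. m \<le> specular_deriv f c"
  proof (cases "\<exists>x\<in>{a<..<b}. g x \<noteq> g a")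
    case True
    then obtain x where "x \<in> {a<..<b}" "g a < g x \<or> g x < g b"
      using ends by force
    then show ?thesis
      using sub [of a x] sub [of x b] by auto
  next
    case False
    then have const: "g x = g a" if "x \<in> {a..b}" for x
      using that ends by (cases "x = a \<or> x = b") auto
    define c where "c = (a + b) / 2"
    have c: "a < c" "c < b"
      using ab by (auto simp: c_def)
    have "m \<le> specular_deriv f c"
    proof (rule specular_deriv_ge [OF _ c(1)])
      show "specularly_differentiable_at f c"
        using diff c by (simp add: specularly_differentiable_on_def)
      show "f x - m * x \<le> f c - m * c" if "x \<in> {a..<c}" for x
        using const [of x] const [of c] that c by (simp add: g_def)
      show "\<exists>x. c < x \<and> x < c + e \<and> f c - m * c \<le> f x - m * x" if e: "e > 0" for e
      proof -
        obtain x where "c < x" "x < min b (c + e)"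
          using dense [of c "min b (c + e)"] c e by auto
        then show ?thesis
          using const [of x] const [of c] c by (intro exI [of _ x]) (simp add: g_def)
      qed
    qed
    with c show ?thesis
      by auto
  qed
  then show ?thesis
    by (simp add: m_def)
qed

theorem theorem3p3:
  fixes f :: "real \<Rightarrow> real" and a b :: real
  assumes "a < b"
    and "continuous_on {a..b} f"
    and "specularly_differentiable_on f {a<..<b}"
  shows "\<exists>c1\<in>{a<..<b}. \<exists>c2\<in>{a<..<b}.
           specular_deriv f c1 \<le> (f b - f a) / (b - a) \<and>
           (f b - f a) / (b - a) \<le> specular_deriv f c2"
proof -
  obtain c2 where c2: "c2 \<in> {a<..<b}" "(f b - f a) / (b - a) \<le> specular_deriv f c2"
    using specular_deriv_ge_slope [OF assms] by blast
  have diff: "specularly_differentiable_at f x" if "x \<in> {a<..<b}" for x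
    using assms(3) that by (simp add: specularly_differentiable_on_def)
  then have "specularly_differentiable_on (\<lambda>x. - f x) {a<..<b}"
    by (simp add: specularly_differentiable_on_def specularly_differentiable_uminus(1))
  then obtain c1 where c1: "c1 \<in> {a<..<b}"
    "(- f b - - f a) / (b - a) \<le> specular_deriv (\<lambda>x. - f x) c1"
    using specular_deriv_ge_slope [OF assms(1) continuous_on_minus [OF assms(2)]] by blast
  have "(- f b - - f a) / (b - a) = - ((f b - f a) / (b - a))"
    by (simp add: minus_divide_left del: divide_minus_left)
  then have "specular_deriv f c1 \<le> (f b - f a) / (b - a)"
    using c1(2) specularly_differentiable_uminus(2) [OF diff [OF c1(1)]] by simp
  with c1(1) c2 show ?thesis
    by blast
qed

end
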